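(* For every transcendental number $t$, there exists an irrational algebraic number $\alpha$ such that $t^{\alpha}$ is transcendental.
   Context: A complex number is algebraic if it is a root of a non-trivial polynomial with rational coefficients; otherwise it is transcendental. Complex powers are $t^{\alpha} = e^{\alpha \ln t}$ with $\ln$ the principal value of the logarithm (argument in $(-\pi,\pi]$). *)

theory Defs
  imports "HOL-Analysis.Complex_Transcendental" "HOL-Computational_Algebra.Polynomial"
begin

text \<open>The library's \<^const>\<open>algebraic\<close> asks for a nonzero polynomial with integer coefficients;
  for rational coefficients see \<open>algebraic_altdef\<close>. Complex \<^const>\<open>powr\<close> is
  \<open>exp (a * Ln z)\<close> for nonzero \<open>z\<close>, where \<^const>\<open>Ln\<close> has imaginary part in \<open>(-pi, pi]\<close>.\<close>

end

theory Submission
  imports Defs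
begin

text \<open>If both \<open>t powr \<i>\<close> and \<open>t powr (1 + \<i>)\<close> were algebraic, then so would be their quotient
  \<open>t\<close>; hence one of \<open>\<i>\<close> and \<open>1 + \<i>\<close> is the required exponent. That algebraic numbers are closed
  under products follows from a dimension count: a number is algebraic iff all its powers lie in
  a finite-dimensional rational vector space.\<close>

text \<open>The scaling that turns any field of characteristic 0 into a rational vector space, so
  that span and dependence can be used.\<close>

definition rat_scale :: "rat \<Rightarrow> 'a \<Rightarrow> 'a :: field_char_0"
  where "rat_scale q x = of_rat q * x"

global_interpretation rat: vector_space rat_scale
  by unfold_locales (simp_all add: rat_scale_def algebra_simps of_rat_add of_rat_mult)

text \<open>The first \<open>card W + 1\<close> powers of x lie in a space spanned by
  \<open>card W\<close> vectors, so they satisfy a rational linear relation, which is a polynomial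
  equation for x.\<close>

lemma algebraic_if_powers_in_span:
  fixes x :: "'a :: field_char_0"
  assumes "finite W" and powers: "\<And>n. x ^ n \<in> rat.span W"
  shows "algebraic x"
\<comment> \<open>Dependence concerns a set of vectors, so it becomes a relation indexed by
  exponents only when the powers are distinct. Two equal powers give a polynomial directly.\<close>
proof (cases "inj_on (\<lambda>n. x ^ n) {..card W}")
  case True
  let ?P = "(\<lambda>n. x ^ n) ` {..card W}"
  have "card ?P = Suc (card W)"
    using True by (simp add: card_image)
  moreover have "?P \<subseteq> rat.span W"
    using powers by blast
  ultimately have "rat.dependent ?P"
    using rat.independent_span_bound[OF \<open>finite W\<close>, of ?P] by fastforce
  then obtain u where u: "\<exists>v\<in>?P. u v \<noteq> 0" "(\<Sum>v\<in>?P. rat_scale (u v) v) = 0"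
    by (auto simp: rat.dependent_finite)
  define p :: "'a poly" where "p = (\<Sum>i\<le>card W. monom (of_rat (u (x ^ i))) i)"
  have coeff_p: "coeff p k = (if k \<le> card W then of_rat (u (x ^ k)) else 0)" for k
    by (simp add: p_def coeff_sum)
  show ?thesis
  proof (rule algebraicI')
    show "coeff p k \<in> \<rat>" for k
      by (simp add: coeff_p)
    obtain i where "i \<le> card W" "u (x ^ i) \<noteq> 0"
      using u(1) by auto
    hence "coeff p i \<noteq> 0"
      by (simp add: coeff_p)
    thus "p \<noteq> 0"
      by auto
    show "poly p x = 0"
      using u(2) True by (simp add: p_def poly_sum poly_monom sum.reindex rat_scale_def)
  qed
next
  case False
  then obtain i j where ij: "i \<noteq> j" "x ^ i = x ^ j"
    by (auto simp: inj_on_def)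
  show ?thesis
  proof (rule algebraicI)
    show "coeff (monom 1 i - monom 1 j :: 'a poly) k \<in> \<int>" for k
      by simp
    show "monom 1 i - monom 1 j \<noteq> (0 :: 'a poly)"
      using ij(1) by (simp add: monom_eq_iff')
    show "poly (monom 1 i - monom 1 j) x = 0"
      using ij(2) by (simp add: poly_monom)
  qed
qed

text \<open>A monic rational equation of degree n expresses \<open>x ^ n\<close> by lower powers,
  and repeated substitution reduces every higher power.\<close>

lemma powers_in_span_if_algebraic:
  fixes x :: "'a :: field_char_0"
  assumes "algebraic x"
  obtains n where "\<And>k. x ^ k \<in> rat.span ((\<lambda>i. x ^ i) ` {..<n})"
proof -
  obtain p where p: "\<And>i. coeff p i \<in> \<rat>" "p \<noteq> 0" "poly p x = 0"
    using assms unfolding algebraic_altdef by blast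
  define n where "n = degree p"
  let ?S = "rat.span ((\<lambda>i. x ^ i) ` {..<n})"
  have "\<exists>r. coeff p i / lead_coeff p = of_rat r" for i
    using Rats_divide[OF p(1) p(1)] by (auto elim!: Rats_cases)
  then obtain q where q: "\<And>i. coeff p i / lead_coeff p = of_rat (q i)"
    by metis
  have "(\<Sum>i<n. coeff p i * x ^ i) + lead_coeff p * x ^ n = 0"
    using p(3) by (simp add: poly_altdef n_def lessThan_Suc_atMost[symmetric])
  hence "x ^ n = - (\<Sum>i<n. coeff p i * x ^ i) / lead_coeff p"
    using p(2) by (simp add: field_simps eq_neg_iff_add_eq_0)
  also have "\<dots> = - (\<Sum>i<n. of_rat (q i) * x ^ i)"
    by (simp add: sum_divide_distrib flip: q)
  finally have x_pow_n: "x ^ n = - (\<Sum>i<n. of_rat (q i) * x ^ i)" .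
  have "x ^ k \<in> ?S" for k
  proof (induction k rule: less_induct)
    case (less k)
    show ?case
    proof (cases "k < n")
      case True
      thus ?thesis by (intro rat.span_base) auto
    next
      case False
      hence "x ^ k = x ^ (k - n) * x ^ n"
        by (simp flip: power_add)
      \<comment> \<open>Since i < n \<le> k, each exponent k - n + i is below k, so the induction
        hypothesis covers every summand.\<close>
      also have "\<dots> = - (\<Sum>i<n. rat_scale (q i) (x ^ (k - n + i)))"
        by (simp add: x_pow_n sum_distrib_left rat_scale_def power_add mult_ac)
      also have "\<dots> \<in> ?S"
        using False by (intro rat.span_neg rat.span_sum rat.span_scale less.IH) auto
      finally show ?thesis .
    qed
  qed
  thus thesis by (rule that)
qed

text \<open>By bilinearity: \<open>right\<close> expands b against a fixed generator from A, then a
  is expanded.\<close>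

lemma mult_in_rat_span:
  fixes a b :: "'a :: field_char_0"
  assumes "a \<in> rat.span A" and "b \<in> rat.span B"
  shows "a * b \<in> rat.span ((\<lambda>(x, y). x * y) ` (A \<times> B))" (is "_ \<in> ?S")
proof -
  have right: "x * b \<in> ?S" if "x \<in> A" for x
    using assms(2)
  proof (induction rule: rat.span_induct_alt)
    case base
    show ?case by (simp add: rat.span_zero)
  next
    case (step c y z)
    have "x * (rat_scale c y + z) = rat_scale c (x * y) + x * z"
      by (simp add: rat_scale_def algebra_simps)
    moreover have "x * y \<in> ?S"
      using that step by (intro rat.span_base) auto
    ultimately show ?case
      using step by (simp add: rat.span_add rat.span_scale)
  qed
  show ?thesis
    using assms(1)
  proof (induction rule: rat.span_induct_alt)
    case base
    show ?case by (simp add: rat.span_zero)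
  next
    case (step c x z)
    have "(rat_scale c x + z) * b = rat_scale c (x * b) + z * b"
      by (simp add: rat_scale_def algebra_simps)
    thus ?case
      using step right by (simp add: rat.span_add rat.span_scale)
  qed
qed

text \<open>All powers of x * y lie in the span of the finitely many products
  \<open>x ^ i * y ^ j\<close> with i < m and j < n.\<close>

lemma algebraic_mult:
  fixes x y :: "'a :: field_char_0"
  assumes "algebraic x" and "algebraic y"
  shows "algebraic (x * y)"
proof -
  obtain m where m: "\<And>k. x ^ k \<in> rat.span ((\<lambda>i. x ^ i) ` {..<m})"
    using powers_in_span_if_algebraic[OF assms(1)] by blast
  obtain n where n: "\<And>k. y ^ k \<in> rat.span ((\<lambda>i. y ^ i) ` {..<n})"
    using powers_in_span_if_algebraic[OF assms(2)] by blast
  show ?thesis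
  proof (rule algebraic_if_powers_in_span)
    show "(x * y) ^ k \<in> rat.span ((\<lambda>(a, b). a * b) `
        (((\<lambda>i. x ^ i) ` {..<m}) \<times> ((\<lambda>i. y ^ i) ` {..<n})))" for k
      unfolding power_mult_distrib by (rule mult_in_rat_span[OF m n])
  qed auto
qed

lemma ii_not_in_Rats: "\<i> \<notin> \<rat>"
  by (auto elim!: Rats_cases' simp: complex_eq_iff)

lemma algebraic_1_plus_ii: "algebraic (1 + \<i>)"
proof (rule algebraicI)
  \<comment> \<open>This is (X - 1)^2 + 1, the polynomial X^2 + 1 of \<i> shifted by 1.\<close>
  show "coeff [:2, -2, 1 :: complex:] i \<in> \<int>" for i
    by (auto simp: coeff_pCons split: nat.splits)
qed (auto simp: algebra_simps)

theorem theorem4: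
  fixes t :: complex
  assumes "\<not> algebraic t"
  shows "\<exists>\<alpha>::complex. \<alpha> \<notin> \<rat> \<and> algebraic \<alpha> \<and> \<not> algebraic (t powr \<alpha>)"
proof (cases "algebraic (t powr \<i>)")
  case False
  thus ?thesis
    using ii_not_in_Rats algebraic_ii by blast
next
  case True
  have "t \<noteq> 0"
    using assms by auto
  \<comment> \<open>Both powers use the same value \<open>Ln t\<close>, so exponents add without
    branch corrections; as t is nonzero, so is \<open>t powr \<i>\<close>, and it cancels.\<close>
  hence "t = t powr (1 + \<i>) * inverse (t powr \<i>)"
    by (simp add: powr_add)
  hence "\<not> algebraic (t powr (1 + \<i>))"
    using assms True algebraic_mult algebraic_inverse by metis
  moreover have "1 + \<i> \<notin> \<rat>"
    using ii_not_in_Rats Rats_diff[of "1 + \<i>" 1] by auto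
  ultimately show ?thesis
    using algebraic_1_plus_ii by blast
qed

end
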